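(* The Thue–Morse constant $\tau_{TM}=\sum_{k=0}^{\infty} t_k 2^{-(k+1)}$ is not badly approximable. Moreover, there exists a constant $c>0$ such that the inequality $$\left|\tau_{TM}-\frac{p}{q}\right|\le \frac{c}{q^2(\log\log q)^2}$$ has infinitely many solutions $(p,q)\in\mathbb{N}^2$.
   Context: The Thue–Morse sequence $(t_n)_{n\ge 0}$ is defined by $t_0=0$, $t_{2n}=t_n$, $t_{2n+1}=1-t_n$ for all $n\ge 0$. A real number $x$ is badly approximable if there is a constant $c>0$ such that $|x-p/q|>c/q^2$ for all integers $p$ and $q\ge 1$. *)

theory Defs
  imports Complex_Main
begin

fun thue_morse :: "nat \<Rightarrow> int" where
  "thue_morse n =
     (if n = 0 then 0
      else if even n then thue_morse (n div 2)
      else 1 - thue_morse (n div 2))"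

declare thue_morse.simps [simp del]

lemma thue_morse_0: "thue_morse 0 = 0"
  by (simp add: thue_morse.simps)

lemma thue_morse_even: "thue_morse (2 * n) = thue_morse n"
  by (cases "n = 0") (simp_all add: thue_morse.simps[of "2 * n"] thue_morse_0)

lemma thue_morse_odd: "thue_morse (2 * n + 1) = 1 - thue_morse n"
  by (subst thue_morse.simps) simp

lemma thue_morse_range: "thue_morse n \<in> {0, 1}"
proof (induction n rule: less_induct)
  case (less n)
  show ?case
  proof (cases "n = 0")
    case True
    then show ?thesis by (simp add: thue_morse_0)
  next
    case False
    then have "thue_morse (n div 2) \<in> {0, 1}" by (intro less) simp
    with False show ?thesis by (subst thue_morse.simps) auto
  qed
qed

definition thue_morse_constant :: real where
  "thue_morse_constant = (\<Sum>k. of_int (thue_morse k) / 2 ^ (k + 1))"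

lemma summable_thue_morse: "summable (\<lambda>k. of_int (thue_morse k) / 2 ^ (k + 1) :: real)"
proof (rule summable_comparison_test')
  show "summable (\<lambda>k. (1 / 2) ^ k :: real)" by (simp add: summable_geometric)
  show "norm (of_int (thue_morse k) / 2 ^ (k + 1) :: real) \<le> (1 / 2) ^ k" for k
    using thue_morse_range[of k] by (auto simp: power_divide field_simps)
qed

definition badly_approximable :: "real \<Rightarrow> bool" where
  "badly_approximable x \<longleftrightarrow>
     (\<exists>c>0. \<forall>p q :: int. q \<ge> 1 \<longrightarrow>
        \<bar>x - of_int p / of_int q\<bar> > c / (of_int q)\<^sup>2)"

end

theory Submission
  imports Defs "HOL-Number_Theory.Cong"
begin

text \<open>
  Let \<open>T(u) = \<Sum> (-1)\<^bsup>t\<^sub>k\<^esup> u\<^sup>k\<close>, so that \<open>T(u) = (1 - u) T(u\<^sup>2)\<close> and \<open>\<tau> = 1/2 - T(1/2)/4\<close>.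
  With \<open>z = 2 ^ 2 ^ l\<close>, \<open>w = z\<^sup>2\<close> and \<open>B = \<Prod>i<l. (2 ^ 2 ^ i - 1)\<close>, iterating the functional equation
  gives \<open>T(1/2) (z + 1) = 2 B (1 - 1/w) T(1/w)\<close>. A fixed Pade approximant \<open>N(w)/D(w)\<close> of
  \<open>(1 - 1/w) T(1/w)\<close> with \<open>deg D = 4\<close> then yields a rational approximation of \<open>\<tau>\<close> with denominator
  \<open>Q = 2 D(w) (z + 1)\<close> and error \<open>O(Q\<^sup>-\<^sup>2)\<close>. Here \<open>B\<close> is divisible by a high power of 3, and \<open>D\<close> has a
  simple 3-adic zero in \<open>4 + 9\<int>\<^sub>3\<close>. Since 2 is a primitive root modulo all powers of 3,
  Hensel lifting along the exponents \<open>l\<close> produces, for every \<open>m\<close>, some \<open>l \<le> 3\<^sup>m\<close> with \<open>3\<^sup>m\<close> dividing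
  \<open>D(w)\<close>. Cancelling \<open>3\<^sup>m\<close> gains a factor \<open>9\<^sup>m\<close>, which is of order \<open>(ln (ln Q))\<^sup>2\<close>, as
  \<open>ln (ln Q)\<close> is at most \<open>l + O(1)\<close>.
\<close>

section \<open>The signed Thue-Morse generating function\<close>

definition thue_morse_gf :: "real \<Rightarrow> real" where
  "thue_morse_gf u = (\<Sum>k. (1 - 2 * of_int (thue_morse k)) * u ^ k)"

lemma abs_thue_morse_sign: "\<bar>1 - 2 * real_of_int (thue_morse k)\<bar> = 1"
  using thue_morse_range[of k] by auto

lemma summable_thue_morse_gf:
  assumes "\<bar>u\<bar> < 1"
  shows "summable (\<lambda>k. (1 - 2 * real_of_int (thue_morse k)) * u ^ k)"
proof (rule summable_comparison_test')
  show "summable (\<lambda>k. \<bar>u\<bar> ^ k)"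
    using assms by (simp add: summable_geometric)
  show "norm ((1 - 2 * real_of_int (thue_morse k)) * u ^ k) \<le> \<bar>u\<bar> ^ k" for k
    by (simp add: abs_mult abs_thue_morse_sign power_abs)
qed

text \<open>Pair the terms of index \<open>2 * n\<close> and \<open>2 * n + 1\<close>: the first has
  the sign of index \<open>n\<close>, the second the opposite sign, so each pair carries a factor
  \<open>1 - u\<close>.\<close>

lemma thue_morse_gf_square:
  assumes "\<bar>u\<bar> < 1"
  shows "thue_morse_gf u = (1 - u) * thue_morse_gf (u\<^sup>2)"
proof -
  define f where "f = (\<lambda>k. (1 - 2 * real_of_int (thue_morse k)) * u ^ k)"
  have "f sums thue_morse_gf u"
    unfolding f_def thue_morse_gf_def
    by (rule summable_sums[OF summable_thue_morse_gf[OF assms]])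
  then have "(\<lambda>n. sum f {n * 2..<n * 2 + 2}) sums thue_morse_gf u"
    by (rule sums_group) simp
  moreover have "sum f {n * 2..<n * 2 + 2} =
      (1 - u) * ((1 - 2 * real_of_int (thue_morse n)) * (u\<^sup>2) ^ n)" for n
  proof -
    have "{n * 2..<n * 2 + 2} = {2 * n, 2 * n + 1}" by auto
    then have "sum f {n * 2..<n * 2 + 2} = f (2 * n) + f (2 * n + 1)" by simp
    moreover have "f (2 * n) = (1 - 2 * real_of_int (thue_morse n)) * (u\<^sup>2) ^ n"
      by (simp only: f_def thue_morse_even power_mult)
    moreover have "f (2 * n + 1) = (1 - 2 * (1 - real_of_int (thue_morse n))) * ((u\<^sup>2) ^ n * u)"
      by (simp only: f_def thue_morse_odd power_mult power_add power_one_right of_int_diff of_int_1)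
    ultimately show ?thesis by (simp add: algebra_simps)
  qed
  ultimately have "(\<lambda>n. (1 - u) * ((1 - 2 * real_of_int (thue_morse n)) * (u\<^sup>2) ^ n))
      sums thue_morse_gf u"
    by simp
  moreover have "\<bar>u\<^sup>2\<bar> < 1" using assms by (simp add: abs_square_less_1)
  then have "(\<lambda>n. (1 - u) * ((1 - 2 * real_of_int (thue_morse n)) * (u\<^sup>2) ^ n))
      sums ((1 - u) * thue_morse_gf (u\<^sup>2))"
    unfolding thue_morse_gf_def
    by (intro sums_mult summable_sums summable_thue_morse_gf)
  ultimately show ?thesis by (rule sums_unique2)
qed

lemma thue_morse_gf_prod:
  assumes "\<bar>u\<bar> < 1"
  shows "thue_morse_gf u = (\<Prod>i<n. 1 - u ^ 2 ^ i) * thue_morse_gf (u ^ 2 ^ n)"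
proof (induction n)
  case (Suc n)
  have "\<bar>u ^ 2 ^ n\<bar> < 1"
    using assms by (simp add: power_abs power_less_one_iff)
  from thue_morse_gf_square[OF this] Suc show ?case
    by (simp add: power_mult[symmetric] mult.commute)
qed simp

text \<open>The constant term is 1, and the rest is dominated by a geometric series with sum
  \<open>u / (1 - u)\<close>.\<close>

lemma thue_morse_gf_near_0:
  assumes "0 \<le> u" "u \<le> 1 / 2"
  shows "\<bar>thue_morse_gf u - 1\<bar> \<le> 2 * u"
proof -
  define f where "f = (\<lambda>k. (1 - 2 * real_of_int (thue_morse k)) * u ^ k)"
  have u: "\<bar>u\<bar> < 1" using assms by simp
  have sf: "summable f" unfolding f_def by (rule summable_thue_morse_gf[OF u])
  have geo: "(\<lambda>k. u * u ^ k) sums (u * (1 / (1 - u)))"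
    using u by (intro sums_mult geometric_sums) simp
  have le: "norm (f (Suc k)) \<le> u * u ^ k" for k
    using assms by (simp add: f_def abs_mult abs_thue_morse_sign power_abs)
  have "thue_morse_gf u - 1 = (\<Sum>k. f (Suc k))"
    using suminf_split_head[OF sf] by (simp add: f_def thue_morse_gf_def thue_morse_0)
  also have "norm \<dots> \<le> (\<Sum>k. u * u ^ k)"
    by (rule norm_suminf_le[OF le sums_summable[OF geo]])
  also have "\<dots> = u * (1 / (1 - u))" using sums_unique[OF geo] by simp
  also have "\<dots> \<le> u * 2"
    using assms by (intro mult_left_mono) (simp_all add: field_simps)
  finally show ?thesis by (simp add: mult.commute)
qed

lemma thue_morse_constant_eq: "thue_morse_constant = 1 / 2 - thue_morse_gf (1 / 2) / 4"
proof -
  have "(\<lambda>k. (1 / 2 :: real) ^ k) sums 2"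
    using geometric_sums[of "1 / 2 :: real"] by simp
  moreover have "(\<lambda>k. (1 - 2 * real_of_int (thue_morse k)) * (1 / 2) ^ k) sums thue_morse_gf (1 / 2)"
    unfolding thue_morse_gf_def by (intro summable_sums summable_thue_morse_gf) simp
  ultimately have "(\<lambda>k. (1 / 4) * ((1 / 2) ^ k - (1 - 2 * real_of_int (thue_morse k)) * (1 / 2) ^ k))
      sums ((1 / 4) * (2 - thue_morse_gf (1 / 2)))"
    by (intro sums_mult sums_diff)
  moreover have "(1 / 4) * ((1 / 2) ^ k - (1 - 2 * real_of_int (thue_morse k)) * (1 / 2) ^ k) =
      of_int (thue_morse k) / 2 ^ (k + 1)" for k
    by (simp add: field_simps)
  ultimately show ?thesis
    unfolding thue_morse_constant_def by (simp add: sums_iff)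
qed

section \<open>Pade approximation in \<open>1 / w\<close>\<close>

text \<open>
  The denominator is the degree-4 orthogonal polynomial for the moments of \<open>(1 - u) T(u)\<close>.
\<close>

definition pade_num :: "'a::comm_ring_1 \<Rightarrow> 'a" where
  "pade_num w = w ^ 4 - 3 * w ^ 3 + 2 * w\<^sup>2 + 3 * w - 4"

definition pade_den :: "'a::comm_ring_1 \<Rightarrow> 'a" where
  "pade_den w = w ^ 4 - w ^ 3 + w + 2"

text \<open>Taken at integers, these bounds will give a positive \<open>q\<close>, control its size,
  and make the numerator \<open>p\<close> nonnegative.\<close>

lemma pade_den_bounds:
  fixes w :: "'a::linordered_idom"
  assumes "2 \<le> w"
  shows "0 < pade_den w" "pade_den w \<le> w ^ 4" "pade_num w \<le> pade_den w"
proof -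
  have "w ^ 3 * 2 \<le> w ^ 3 * w" using assms by (intro mult_left_mono) auto
  then have 4: "w ^ 4 \<ge> 2 * w ^ 3" by (simp add: eval_nat_numeral mult_ac)
  have "w\<^sup>2 * 2 \<le> w\<^sup>2 * w" using assms by (intro mult_left_mono) auto
  then have 3: "w ^ 3 \<ge> 2 * w\<^sup>2" by (simp add: eval_nat_numeral mult_ac)
  have 2: "w\<^sup>2 \<ge> 2 * w" using assms by (simp add: power2_eq_square)
  show "0 < pade_den w" "pade_den w \<le> w ^ 4" "pade_num w \<le> pade_den w"
    unfolding pade_den_def pade_num_def using 2 3 4 assms by linarith+
qed

text \<open>In \<open>u = 1 / w\<close>, the product of the reversed denominator with
  \<open>(1 - u) * thue_morse_gf u\<close> agrees with the reversed numerator below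
  \<open>u ^ 9\<close>: the coefficients of \<open>u ^ 5\<close> to \<open>u ^ 8\<close> vanish.
  Scaling by \<open>w ^ 4\<close> leaves an error of order \<open>w ^ -5\<close>.\<close>

lemma pade_error:
  fixes w :: real
  assumes "2 \<le> w"
  shows "\<bar>pade_den w * ((1 - 1 / w) * thue_morse_gf (1 / w)) - pade_num w\<bar> \<le> 200 / w ^ 5"
proof -
  define u where "u = 1 / w"
  have u: "0 < u" "u \<le> 1 / 2" using assms by (simp_all add: u_def field_simps)
  have pow: "0 \<le> u ^ k \<and> u ^ k \<le> 1" for k
    using u by (simp add: power_le_one)
  \<comment> \<open>\<open>Q\<close> keeps only the first four factors of the infinite product,
    \<open>u ^ 9 * R\<close> is its part beyond the numerator, and \<open>e\<close> accounts for the
    remaining factors, which first matter at \<open>u ^ 16\<close>.\<close>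
  define Q where "Q = (1 - u + u ^ 3 + 2 * u ^ 4) * ((1 - u) * ((1 - u) * (1 - u\<^sup>2) * (1 - u ^ 4) * (1 - u ^ 8)))"
  define R where "R = 6 - 4 * u - 6 * u\<^sup>2 + 6 * u ^ 3 - u ^ 7 - 3 * u ^ 8 + 2 * u ^ 9 + 3 * u ^ 10 - 2 * u ^ 11"
  define e where "e = thue_morse_gf (u ^ 16) - 1"
  have Q_eq: "Q = (1 - 3 * u + 2 * u\<^sup>2 + 3 * u ^ 3 - 4 * u ^ 4) + u ^ 9 * R"
    unfolding Q_def R_def by algebra
  \<comment> \<open>33 is the sum of the absolute values of the coefficients of
    \<open>R\<close>.\<close>
  have R_le: "\<bar>R\<bar> \<le> 33"
    unfolding R_def
    using u pow[of 1] pow[of 2] pow[of 3] pow[of 7] pow[of 8] pow[of 9] pow[of 10] pow[of 11] by linarith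
  have "\<bar>u ^ 9 * R\<bar> \<le> 1 * 33"
    unfolding abs_mult using R_le pow[of 9] by (intro mult_mono) auto
  then have Q_le: "\<bar>Q\<bar> \<le> 50"
    unfolding Q_eq using u pow[of 2] pow[of 3] pow[of 4] by linarith
  have "u ^ 16 \<le> u ^ 1" using u by (intro power_decreasing) auto
  then have "\<bar>e\<bar> \<le> 2 * u ^ 16"
    unfolding e_def using u pow[of 16] by (intro thue_morse_gf_near_0) auto
  then have "\<bar>Q * e\<bar> \<le> 50 * (2 * u ^ 16)"
    unfolding abs_mult using Q_le by (intro mult_mono) auto
  moreover have "u ^ 16 \<le> u ^ 9" using u by (intro power_decreasing) auto
  ultimately have Qe: "\<bar>Q * e\<bar> \<le> 100 * u ^ 9" by linarith
  have uR: "\<bar>u ^ 9 * R\<bar> \<le> u ^ 9 * 33"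
    unfolding abs_mult using R_le pow[of 9] by (intro mult_mono) auto
  have err: "\<bar>u ^ 9 * R + Q * e\<bar> \<le> 200 * u ^ 9"
    using Qe uR pow[of 9] by linarith
  have gf: "thue_morse_gf u = (1 - u) * (1 - u\<^sup>2) * (1 - u ^ 4) * (1 - u ^ 8) * (1 + e)"
    using thue_morse_gf_prod[of u 4] u by (simp add: e_def eval_nat_numeral mult_ac)
  have w: "w \<noteq> 0" "w * u = 1" using assms by (simp_all add: u_def)
  have den: "pade_den w = w ^ 4 * (1 - u + u ^ 3 + 2 * u ^ 4)"
    using w(2) unfolding pade_den_def by algebra
  have "pade_den w * ((1 - u) * thue_morse_gf u) = w ^ 4 * (Q * (1 + e))"
    unfolding gf Q_def den by (simp only: mult_ac)
  moreover have "pade_num w = w ^ 4 * (Q - u ^ 9 * R)"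
    unfolding Q_eq pade_num_def using w(2) by algebra
  ultimately have "pade_den w * ((1 - u) * thue_morse_gf u) - pade_num w = w ^ 4 * (u ^ 9 * R + Q * e)"
    by (simp add: algebra_simps)
  also have "\<bar>\<dots>\<bar> \<le> w ^ 4 * (200 * u ^ 9)"
    unfolding abs_mult[of "w ^ 4"] using err assms by (intro mult_mono) auto
  also have "\<dots> = 200 / w ^ 5"
    using w(1) by (simp add: u_def field_simps flip: power_add)
  finally show ?thesis unfolding u_def .
qed

section \<open>3-adic valuations and lifting along the exponent\<close>

text \<open>Cubing \<open>1 + 3 * x * a\<close> raises the valuation of the part after 1 by exactly
  one and keeps \<open>a\<close> modulo 3. The cofactor being 1 modulo 3, not merely a unit, fixes
  the digit in the lifting below.\<close>

lemma four_power_three_power: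
  "\<exists>k::nat. (4::nat) ^ 3 ^ j = 1 + 3 ^ (j + 1) * (1 + 3 * k)"
proof (induction j)
  case 0
  have "(4::nat) ^ 3 ^ 0 = 1 + 3 ^ (0 + 1) * (1 + 3 * 0)" by simp
  then show ?case by blast
next
  case (Suc j)
  then obtain k :: nat where k: "(4::nat) ^ 3 ^ j = 1 + 3 ^ (j + 1) * (1 + 3 * k)" by blast
  define a where "a = 1 + 3 * k"
  define x :: nat where "x = 3 ^ j"
  have "(4::nat) ^ 3 ^ Suc j = (4 ^ 3 ^ j) ^ 3"
    by (simp add: power_mult[symmetric] mult.commute)
  also have "\<dots> = (1 + 3 * x * a) ^ 3"
    unfolding k a_def x_def by simp
  also have "\<dots> = 1 + 9 * x * (a + 3 * (x * a\<^sup>2 + x\<^sup>2 * a ^ 3))"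
    by (simp add: eval_nat_numeral algebra_simps)
  also have "\<dots> = 1 + 3 ^ (Suc j + 1) * (1 + 3 * (k + x * a\<^sup>2 + x\<^sup>2 * a ^ 3))"
    by (simp add: a_def x_def)
  finally show ?case by blast
qed

lemma one_plus_power_second_order:
  fixes x :: "'a::comm_semiring_1"
  shows "\<exists>r. (1 + x) ^ c = 1 + of_nat c * x + x\<^sup>2 * r"
proof (induction c)
  case 0
  then show ?case by (intro exI[of _ 0]) simp
next
  case (Suc c)
  then obtain r where "(1 + x) ^ c = 1 + of_nat c * x + x\<^sup>2 * r" by blast
  then have "(1 + x) ^ Suc c = 1 + of_nat (Suc c) * x + x\<^sup>2 * (of_nat c + r + x * r)"
    by (simp add: algebra_simps power2_eq_square)
  then show ?case by blast
qed

text \<open>The inner exponent \<open>2 ^ l\<close> grows by \<open>3 ^ (j + 1) * c\<close>, and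
  \<open>4 ^ 3 ^ (j + 1)\<close> is 1 plus \<open>3 ^ (j + 2)\<close> times a unit, so the linear
  binomial term dictates the change. Evenness of \<open>l\<close> makes \<open>2 ^ l\<close>, hence
  \<open>c\<close>, equal to 1 modulo 3.\<close>

lemma double_exponential_shift:
  assumes "even l"
  shows "\<exists>y::int. 4 ^ 2 ^ (l + 2 * 3 ^ j) = 4 ^ 2 ^ l + 3 ^ (j + 2) * (1 + 3 * y)"
proof -
  define w :: int where "w = 4 ^ 2 ^ l"
  obtain k :: nat where k: "(4::nat) ^ 3 ^ j = 1 + 3 ^ (j + 1) * (1 + 3 * k)"
    using four_power_three_power by blast
  obtain t :: nat where t: "(4::nat) ^ 3 ^ (j + 1) = 1 + 3 ^ (j + 1 + 1) * (1 + 3 * t)"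
    using four_power_three_power by blast
  define c where "c = 2 ^ l * (1 + 3 * k)"
  define x :: int where "x = 3 ^ (j + 2) * (1 + 3 * int t)"
  obtain r where r: "(1 + x) ^ c = 1 + of_nat c * x + x\<^sup>2 * r"
    using one_plus_power_second_order by blast
  have x: "(4::int) ^ 3 ^ (j + 1) = 1 + x"
    using arg_cong[OF t, of int] by (simp add: x_def algebra_simps)
  have "(2::nat) ^ (l + 2 * 3 ^ j) = 2 ^ l * 4 ^ 3 ^ j"
    by (simp add: power_add power_mult)
  also have "\<dots> = 2 ^ l + 3 ^ (j + 1) * c"
    unfolding k c_def by (simp add: algebra_simps)
  finally have "(4::int) ^ 2 ^ (l + 2 * 3 ^ j) = w * (4 ^ 3 ^ (j + 1)) ^ c"
    by (simp only: w_def power_add power_mult)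
  also have "\<dots> = w + 3 ^ (j + 2) * (w * (1 + 3 * int t) * int c + 3 * (w * 3 ^ (j + 1) * (1 + 3 * int t)\<^sup>2 * r))"
    (is "_ = w + 3 ^ (j + 2) * ?b")
    unfolding x r by (simp add: x_def algebra_simps power2_eq_square)
  finally have eq: "4 ^ 2 ^ (l + 2 * 3 ^ j) = w + 3 ^ (j + 2) * ?b" .
  have pow4: "[(4::int) ^ n = 1] (mod 3)" for n
    using cong_pow[of "4::int" 1 3 n] by (simp add: cong_def)
  have "[(2::int) ^ l = 1] (mod 3)"
    using assms pow4 by (auto elim!: evenE simp: power_mult)
  then have "[int c = 1 * 1] (mod 3)"
    unfolding c_def of_nat_mult by (intro cong_mult) (simp_all add: cong_def)
  then have "[?b = 1 * 1 * (1 * 1) + 0] (mod 3)"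
    unfolding w_def using pow4 by (intro cong_add cong_mult) (simp_all add: cong_def)
  then have "3 dvd ?b - 1" by (simp add: cong_iff_dvd_diff)
  then obtain y where "?b = 1 + 3 * y" by (metis dvdE add.commute diff_add_cancel)
  with eq show ?thesis unfolding w_def by auto
qed

text \<open>Hensel step: at \<open>w\<close> congruent to 1 the derivative
  \<open>4 * w ^ 3 - 3 * w\<^sup>2 + 1\<close> is 2 modulo 3, so the shift changes the next 3-adic
  digit by 2.\<close>

lemma pade_den_shift:
  fixes w y :: int
  assumes "[w = 1] (mod 3)" "0 < m"
  shows "[pade_den (w + 3 ^ m * (1 + 3 * y)) = pade_den w + 2 * 3 ^ m] (mod 3 ^ Suc m)"
proof -
  define d where "d = 3 ^ m * (1 + 3 * y)"
  \<comment> \<open>The exact difference quotient of \<open>pade_den\<close> between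
    \<open>w\<close> and \<open>w + d\<close>: the derivative plus a multiple of
    \<open>d\<close>.\<close>
  define e where "e = 4 * w ^ 3 - 3 * w\<^sup>2 + 1 + d * (6 * w\<^sup>2 - 3 * w + 4 * d * w - d + d\<^sup>2)"
  have "[d = 0] (mod 3)"
    using assms(2) by (simp add: cong_0_iff d_def)
  then have "[e = 4 * 1 ^ 3 - 3 * 1\<^sup>2 + 1 + 0 * (6 * w\<^sup>2 - 3 * w + 4 * d * w - d + d\<^sup>2)] (mod 3)"
    unfolding e_def using assms(1)
    by (intro cong_add cong_diff cong_mult cong_pow cong_refl) auto
  then have "[(1 + 3 * y) * e = 1 * 2] (mod 3)"
    by (intro cong_mult) (simp_all add: cong_def)
  then have "3 dvd (1 + 3 * y) * e - 2" by (simp add: cong_iff_dvd_diff)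
  then have "3 ^ m * 3 dvd 3 ^ m * ((1 + 3 * y) * e - 2)" by (intro mult_dvd_mono) simp_all
  moreover have "pade_den (w + d) = pade_den w + d * e"
    unfolding pade_den_def e_def by algebra
  then have "pade_den (w + d) - (pade_den w + 2 * 3 ^ m) = 3 ^ m * ((1 + 3 * y) * e - 2)"
    by (simp add: d_def algebra_simps)
  ultimately show ?thesis by (simp add: cong_iff_dvd_diff d_def mult.commute)
qed

text \<open>Each increase of \<open>l\<close> by \<open>2 * 3 ^ j\<close> adds
  \<open>2 * 3 ^ (j + 2)\<close> modulo \<open>3 ^ (j + 3)\<close>, so one of three consecutive
  shifts clears the next digit. The upper bound on \<open>l\<close> makes the gain comparable to the
  iterated logarithm; the lower bound lets the same power of 3 divide the product of the
  \<open>2 ^ 2 ^ i - 1\<close>.\<close>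

lemma three_power_dvd_pade_den:
  "\<exists>l. even l \<and> j + 3 \<le> l \<and> l \<le> 3 ^ (j + 2) \<and> (3::int) ^ (j + 2) dvd pade_den (4 ^ 2 ^ l)"
proof (induction j)
  case 0
  \<comment> \<open>Start at \<open>l = 6\<close>: the powers of 4 have period 3 modulo 9, and
    \<open>pade_den 4 = 198 = 9 * 22\<close>.\<close>
  have "[(4::int) ^ 2 ^ 6 = 4] (mod 9)" by (simp add: cong_def)
  then have "[pade_den ((4::int) ^ 2 ^ 6) = pade_den 4] (mod 9)"
    unfolding pade_den_def by (intro cong_add cong_diff cong_pow cong_refl)
  then have "(3::int) ^ (0 + 2) dvd pade_den (4 ^ 2 ^ 6)"
    by (simp add: cong_def pade_den_def mod_eq_0_iff_dvd)
  then show ?case by (intro exI[of _ 6]) simp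
next
  case (Suc j)
  then obtain l s where l: "even l" "j + 3 \<le> l" "l \<le> 3 ^ (j + 2)"
    and s: "pade_den (4 ^ 2 ^ l) = (3::int) ^ (j + 2) * s" by auto
  have shift: "[pade_den (4 ^ 2 ^ (l + t * (2 * 3 ^ j))) = 3 ^ (j + 2) * (s + 2 * int t)] (mod 3 ^ (j + 3))" for t
  proof (induction t)
    case 0
    then show ?case by (simp add: s)
  next
    case (Suc t)
    let ?l = "l + t * (2 * 3 ^ j)"
    have "even ?l" using l by simp
    then obtain y where y: "(4::int) ^ 2 ^ (?l + 2 * 3 ^ j) = 4 ^ 2 ^ ?l + 3 ^ (j + 2) * (1 + 3 * y)"
      using double_exponential_shift by blast
    have "[(4::int) ^ 2 ^ ?l = 1] (mod 3)"
      using cong_pow[of "4::int" 1 3 "2 ^ ?l"] by (simp add: cong_def)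
    from pade_den_shift[OF this, of "j + 2" y]
    have "[pade_den (4 ^ 2 ^ (?l + 2 * 3 ^ j)) = pade_den (4 ^ 2 ^ ?l) + 2 * 3 ^ (j + 2)] (mod (3::int) ^ (j + 3))"
      unfolding y by (simp add: power_add mult.commute)
    also have "[pade_den (4 ^ 2 ^ ?l) + 2 * 3 ^ (j + 2) = 3 ^ (j + 2) * (s + 2 * int t) + 2 * 3 ^ (j + 2)] (mod (3::int) ^ (j + 3))"
      using Suc by (intro cong_add cong_refl)
    finally show ?case by (simp add: algebra_simps)
  qed
  \<comment> \<open>The residues are represented by 1, 2, 3 instead of 0, 1, 2, so that
    \<open>l\<close> strictly increases and the lower bound survives.\<close>
  have "3 dvd s + 2 * int 1 \<or> 3 dvd s + 2 * int 2 \<or> 3 dvd s + 2 * int 3" by simp presburger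
  then obtain t :: nat where t: "1 \<le> t" "t \<le> 3" "3 dvd s + 2 * int t"
    by (metis one_le_numeral order_refl numeral_le_iff semiring_norm(69,72))
  have "(3::int) ^ (j + 2) * 3 dvd 3 ^ (j + 2) * (s + 2 * int t)"
    using t by (intro mult_dvd_mono) simp_all
  then have "(3::int) ^ (j + 3) dvd 3 ^ (j + 2) * (s + 2 * int t)"
    by (simp add: power_add mult.commute)
  then have dvd: "(3::int) ^ (Suc j + 2) dvd pade_den (4 ^ 2 ^ (l + t * (2 * 3 ^ j)))"
    using cong_dvd_iff[OF shift[of t]] by (simp add: power_add mult.commute)
  have "1 * (2 * 1) \<le> t * (2 * 3 ^ j)"
    using t by (intro mult_le_mono) simp_all
  moreover have "t * (2 * 3 ^ j) \<le> 3 * (2 * 3 ^ j)"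
    using t by (intro mult_right_mono) simp_all
  moreover have "(3::nat) ^ (j + 2) = 9 * 3 ^ j" "(3::nat) ^ (Suc j + 2) = 27 * 3 ^ j" by simp_all
  ultimately have "Suc j + 3 \<le> l + t * (2 * 3 ^ j)" "l + t * (2 * 3 ^ j) \<le> 3 ^ (Suc j + 2)"
    using l(2,3) by linarith+
  with dvd show ?case
    using l(1) by (intro exI[of _ "l + t * (2 * 3 ^ j)"]) simp
qed

text \<open>The factor for \<open>i = 0\<close> is 1; every later one is a power of 4 minus 1, hence
  a multiple of 3.\<close>

lemma three_power_dvd_prod:
  "(3::int) ^ m dvd (\<Prod>i<Suc m. 2 ^ 2 ^ i - 1)"
proof (induction m)
  case (Suc m)
  have "[(4::int) ^ 2 ^ m = 1] (mod 3)"
    using cong_pow[of "4::int" 1 3 "2 ^ m"] by (simp add: cong_def)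
  then have "(3::int) dvd 2 ^ 2 ^ Suc m - 1"
    by (simp add: cong_iff_dvd_diff power_mult)
  with Suc show ?case
    by (subst prod.lessThan_Suc) (simp add: mult.commute mult_dvd_mono)
qed simp

section \<open>The iterated functional equation with cleared denominators\<close>

lemma fermat_prod_bounds:
  "0 \<le> (\<Prod>i<l. 2 ^ 2 ^ i - 1 :: int)" "(\<Prod>i<l. 2 ^ 2 ^ i - 1 :: int) \<le> 2 ^ 2 ^ l"
proof -
  show nonneg: "0 \<le> (\<Prod>i<l. 2 ^ 2 ^ i - 1 :: int)" for l :: nat
    by (intro prod_nonneg) simp
  show "(\<Prod>i<l. 2 ^ 2 ^ i - 1 :: int) \<le> 2 ^ 2 ^ l"
  proof (induction l)
    case (Suc l)
    have "(\<Prod>i<l. 2 ^ 2 ^ i - 1 :: int) * (2 ^ 2 ^ l - 1) \<le> 2 ^ 2 ^ l * 2 ^ 2 ^ l"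
      using Suc nonneg by (intro mult_mono) auto
    then show ?case by (simp add: mult_2 flip: power_add)
  qed simp
qed

text \<open>After \<open>l\<close> steps down to \<open>1 / z\<close>, one more step yields a factor
  \<open>1 - 1 / z\<close>, which \<open>(z + 1) / z\<close> completes to
  \<open>1 - 1 / z\<^sup>2\<close>.\<close>

lemma thue_morse_gf_half:
  fixes z :: real and l :: nat
  defines "z \<equiv> 2 ^ 2 ^ l"
  shows "thue_morse_gf (1 / 2) * (z + 1) =
    2 * (\<Prod>i<l. 2 ^ 2 ^ i - 1) * ((1 - 1 / z\<^sup>2) * thue_morse_gf (1 / z\<^sup>2))"
proof -
  have z: "z \<ge> 2"
    unfolding z_def using power_increasing[of 1 "2 ^ l" "2::real"] by simp
  \<comment> \<open>The product of the \<open>2 ^ 2 ^ i\<close> for \<open>i < l\<close> is only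
    \<open>2 ^ (2 ^ l - 1)\<close>, whence the factor 2.\<close>
  have "(\<Prod>i<l. 1 - (1 / 2) ^ 2 ^ i) * 2 ^ 2 ^ l = 2 * (\<Prod>i<l. 2 ^ 2 ^ i - 1 :: real)"
  proof (induction l)
    case (Suc l)
    have "(\<Prod>i<Suc l. 1 - (1 / 2) ^ 2 ^ i) * 2 ^ 2 ^ Suc l =
        ((\<Prod>i<l. 1 - (1 / 2) ^ 2 ^ i) * 2 ^ 2 ^ l) * ((1 - (1 / 2) ^ 2 ^ l) * (2 ^ 2 ^ l :: real))"
      by (simp add: mult_2 power_add)
    also have "(1 - (1 / 2) ^ 2 ^ l) * (2 ^ 2 ^ l :: real) = 2 ^ 2 ^ l - 1"
      by (simp add: power_divide field_simps)
    finally show ?case using Suc by simp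
  qed simp
  then have prod: "(\<Prod>i<l. 1 - (1 / 2) ^ 2 ^ i) = 2 * (\<Prod>i<l. 2 ^ 2 ^ i - 1) / z"
    using z by (simp add: z_def field_simps)
  have "thue_morse_gf (1 / 2) = (\<Prod>i<l. 1 - (1 / 2) ^ 2 ^ i) * thue_morse_gf ((1 / 2) ^ 2 ^ l)"
    by (rule thue_morse_gf_prod) simp
  also have "(1 / 2 :: real) ^ 2 ^ l = 1 / z"
    by (simp add: z_def power_divide)
  also have "thue_morse_gf (1 / z) = (1 - 1 / z) * thue_morse_gf (1 / z\<^sup>2)"
    using thue_morse_gf_square[of "1 / z"] z by (simp add: power_divide)
  finally have "thue_morse_gf (1 / 2) * (z + 1) =
      2 * (\<Prod>i<l. 2 ^ 2 ^ i - 1) * (((1 - 1 / z) * (z + 1) / z) * thue_morse_gf (1 / z\<^sup>2))"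
    unfolding prod by simp
  also have "(1 - 1 / z) * (z + 1) / z = 1 - 1 / z\<^sup>2"
    using z by (simp add: field_simps power2_eq_square)
  finally show ?thesis .
qed

section \<open>Iterated logarithms and the rational approximations\<close>

lemma ln_ln_le:
  fixes x :: real
  assumes "1 < x" "x \<le> 2 ^ 2 ^ n"
  shows "ln (ln x) \<le> n"
proof -
  have ln2: "ln 2 \<le> (1::real)" using ln_le_minus_one[of "2::real"] by simp
  have "ln x \<le> ln (2 ^ 2 ^ n)" using assms by simp
  also have "\<dots> = 2 ^ n * ln 2" by (simp add: ln_realpow)
  also have "\<dots> \<le> 2 ^ n * 1" using ln2 by (intro mult_left_mono) auto
  finally have "ln (ln x) \<le> ln (2 ^ n)" using assms by simp
  also have "\<dots> = n * ln 2" by (simp add: ln_realpow)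
  also have "\<dots> \<le> real n * 1" using ln2 by (intro mult_left_mono) auto
  finally show ?thesis by simp
qed

lemma ln_ln_pos:
  fixes x :: real
  assumes "3 < x"
  shows "0 < ln (ln x)"
proof -
  have "exp 1 < exp (ln x)" using exp_le assms by simp
  then have "1 < ln x" by (simp only: exp_less_cancel_iff)
  then show ?thesis by simp
qed

text \<open>Before cancellation the denominator \<open>W'\<close> is at most
  \<open>4 * x ^ 9\<close>, while \<open>B\<close> is at most \<open>x\<close> and the Pade error is
  of order \<open>x ^ -10\<close>; so the error is \<open>O(1 / W'^2)\<close>. Cancelling
  \<open>3 ^ m\<close> turns \<open>W'^2\<close> into \<open>9 ^ m * q^2\<close>.\<close>

lemma thue_morse_good_approximation:
  obtains p q :: nat where "3 < q" "N \<le> q"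
    "\<bar>thue_morse_constant - real p / real q\<bar> \<le> 3200 / ((real q)\<^sup>2 * (ln (ln (real q)))\<^sup>2)"
proof -
  define m where "m = N + 2"
  obtain l where l: "N + 3 \<le> l" "l \<le> 3 ^ m" "(3::int) ^ m dvd pade_den (4 ^ 2 ^ l)"
    unfolding m_def using three_power_dvd_pade_den by blast
  define z :: int where "z = 2 ^ 2 ^ l"
  define w where "w = z\<^sup>2"
  define B :: int where "B = (\<Prod>i<l. 2 ^ 2 ^ i - 1)"
  have w_eq: "w = 4 ^ 2 ^ l"
    by (simp add: w_def z_def power2_eq_square flip: power_mult_distrib)
  have "l < 2 ^ l" "2 ^ l < (2::nat) ^ 2 ^ l" by simp_all
  then have "int l < int (2 ^ 2 ^ l)" by linarith
  then have lz: "int l < z" by (simp add: z_def)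
  then have z: "z \<ge> 2" using l by linarith
  then have w2: "w \<ge> 2" using mult_mono[of 2 z 1 z] by (simp add: w_def power2_eq_square)
  have B: "0 \<le> B" "B \<le> z" unfolding B_def z_def by (rule fermat_prod_bounds)+
  obtain s where s: "pade_den w = 3 ^ m * s" using l(3) unfolding w_eq by auto
  have "(3::int) ^ m dvd 3 ^ (l - 1)" using l by (intro le_imp_power_dvd) (simp add: m_def)
  also have "\<dots> dvd B" using three_power_dvd_prod[of "l - 1"] l by (simp add: B_def)
  finally obtain b where b: "B = 3 ^ m * b" by auto
  note den = pade_den_bounds[OF w2]
  have s_pos: "0 < s" using den(1) by (simp add: s zero_less_mult_iff)
  have b_nonneg: "0 \<le> b" using B(1) by (auto simp: b zero_le_mult_iff dest: leD)
  \<comment> \<open>Replacing the Pade remainder by 0 in 1/2 - T(1/2)/4 gives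
    \<open>(D * (z + 1) - B * N) / (2 * D * (z + 1))\<close>, with \<open>D\<close>,
    \<open>N\<close> the values of \<open>pade_den\<close>, \<open>pade_num\<close> at
    \<open>w\<close>; \<open>3 ^ m\<close> is cancelled from \<open>D\<close> and
    \<open>B\<close>.\<close>
  define p where "p = s * (z + 1) - b * pade_num w"
  define q where "q = 2 * (s * (z + 1))"
  have "z < 2 * v" if "1 * (z + 1) \<le> v" for v using that z by simp
  moreover have "1 * (z + 1) \<le> s * (z + 1)" using s_pos z by (intro mult_right_mono) auto
  ultimately have q_ge: "z < q" unfolding q_def by blast
  have W: "3 ^ m * q = 2 * (pade_den w * (z + 1))" by (simp add: q_def s)
  have p3: "3 ^ m * p = pade_den w * (z + 1) - B * pade_num w"
    by (simp add: p_def s b algebra_simps)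
  have "B * pade_num w \<le> B * pade_den w" using den B by (intro mult_left_mono) auto
  also have "\<dots> \<le> (z + 1) * pade_den w" using den B by (intro mult_right_mono) auto
  finally have "0 \<le> 3 ^ m * p" unfolding p3 by (simp add: mult.commute)
  then have p_nonneg: "0 \<le> p" by (auto simp: zero_le_mult_iff dest: leD)
  have "pade_den w * (z + 1) \<le> w ^ 4 * (2 * z)" using den z by (intro mult_mono) auto
  also have "\<dots> = 2 * z ^ 9" by (simp add: w_def eval_nat_numeral)
  finally have W_le: "3 ^ m * q \<le> 4 * z ^ 9" unfolding W by simp

  define x where "x = real_of_int z"
  define W' where "W' = (3 ^ m * real_of_int q)"
  define E where "E = pade_den (x\<^sup>2) * ((1 - 1 / x\<^sup>2) * thue_morse_gf (1 / x\<^sup>2)) - pade_num (x\<^sup>2)"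
  have x: "x \<ge> 2" "x = 2 ^ 2 ^ l" using z by (simp add: x_def) (simp add: x_def z_def)
  have "real_of_int 2 \<le> real_of_int w" using w2 by (simp only: of_int_le_iff)
  then have x2: "x\<^sup>2 \<ge> 2" by (simp add: w_def x_def)
  have E_le: "\<bar>E\<bar> \<le> 200 / (x\<^sup>2) ^ 5" unfolding E_def by (rule pade_error[OF x2])
  have "real_of_int (3 ^ m * q) \<le> real_of_int (4 * z ^ 9)" using W_le by (simp only: of_int_le_iff)
  then have W'_le: "W' \<le> 4 * x ^ 9" by (simp add: W'_def x_def)
  have W'_pos: "0 < W'" using q_ge z by (simp add: W'_def)
  have W'_eq: "W' = 2 * (pade_den (x\<^sup>2) * (x + 1))"
    using arg_cong[OF W, of real_of_int] by (simp add: W'_def x_def pade_den_def w_def)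
  have Bx: "real_of_int B = (\<Prod>i<l. 2 ^ 2 ^ i - 1)" by (simp add: B_def)
  have p': "3 ^ m * real_of_int p = pade_den (x\<^sup>2) * (x + 1) - B * pade_num (x\<^sup>2)"
    using arg_cong[OF p3, of real_of_int] by (simp add: x_def pade_den_def pade_num_def w_def)
  have "pade_den (x\<^sup>2) * (thue_morse_gf (1 / 2) * (x + 1)) = 2 * B * (E + pade_num (x\<^sup>2))"
    unfolding x(2) thue_morse_gf_half by (simp add: E_def x(2) Bx algebra_simps)
  then have "thue_morse_constant * W' = 3 ^ m * real_of_int p - B * E"
    unfolding thue_morse_constant_eq W'_eq p' by (simp add: algebra_simps)
  then have "thue_morse_constant = (3 ^ m * real_of_int p - B * E) / W'"
    using W'_pos by (simp add: field_simps)
  also have "\<dots> = real_of_int p / real_of_int q - B * E / W'"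
    by (simp add: W'_def diff_divide_distrib)
  finally have diff: "thue_morse_constant - real_of_int p / real_of_int q = - (B * E) / W'"
    by simp
  have "\<bar>B * E\<bar> \<le> x * (200 / (x\<^sup>2) ^ 5)"
    unfolding abs_mult using B E_le x(1) by (intro mult_mono) (auto simp: x_def)
  \<comment> \<open>Written with \<open>4 * x ^ 9\<close> to be compared with
    \<open>W'\<close>.\<close>
  also have "\<dots> = 800 / (4 * x ^ 9)"
    using x(1) by (simp add: field_simps flip: power_mult power_Suc)
  also have "\<dots> \<le> 800 / W'" using W'_le W'_pos x(1) by (intro divide_left_mono) auto
  finally have "\<bar>B * E\<bar> / W' \<le> 800 / W' / W'" using W'_pos by (intro divide_right_mono) auto
  also have "\<dots> = 800 / ((3 ^ m)\<^sup>2 * (real_of_int q)\<^sup>2)"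
    by (simp add: W'_def power2_eq_square mult_ac)
  finally have err: "\<bar>thue_morse_constant - real_of_int p / real_of_int q\<bar>
      \<le> 800 / ((3 ^ m)\<^sup>2 * (real_of_int q)\<^sup>2)"
    unfolding diff using W'_pos by simp

  have "real_of_int q * 1 \<le> real_of_int q * 3 ^ m" using q_ge z by (intro mult_left_mono) auto
  also have "\<dots> \<le> 4 * x ^ 9" using W'_le by (simp add: W'_def mult.commute)
  \<comment> \<open>Rounding the exponent up to 16 makes the bound a double power of 2.\<close>
  also have "\<dots> \<le> x ^ 7 * x ^ 9"
    using power_mono[of 2 x 7] x by (intro mult_right_mono) auto
  also have "\<dots> = 2 ^ 2 ^ (l + 4)"
    by (simp add: x(2) power_add[symmetric] flip: power_mult) (simp add: power_add)
  finally have "ln (ln q) \<le> real (l + 4)" using q_ge z by (intro ln_ln_le) auto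
  moreover have "(3::nat) ^ 2 \<le> 3 ^ m" by (intro power_increasing) (simp_all add: m_def)
  then have "real (l + 4) \<le> real (2 * 3 ^ m)" using l(2) by (subst of_nat_le_iff) simp
  ultimately have ll: "ln (ln q) \<le> 2 * 3 ^ m" by simp
  have ll_pos: "0 < ln (ln q)" using q_ge lz l by (intro ln_ln_pos) auto
  \<comment> \<open>The factor 4 appearing here turns 800 into 3200.\<close>
  have "(ln (ln q))\<^sup>2 \<le> (2 * 3 ^ m)\<^sup>2" using ll ll_pos by (intro power_mono) auto
  then have "(real_of_int q)\<^sup>2 * (ln (ln q))\<^sup>2 \<le> (real_of_int q)\<^sup>2 * (4 * (3 ^ m)\<^sup>2)"
    by (intro mult_left_mono) (auto simp: power_mult_distrib)
  then have "3200 / ((real_of_int q)\<^sup>2 * (4 * (3 ^ m)\<^sup>2)) \<le> 3200 / ((real_of_int q)\<^sup>2 * (ln (ln q))\<^sup>2)"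
    using ll_pos q_ge z by (intro divide_left_mono) auto
  with err have "\<bar>thue_morse_constant - real_of_int p / real_of_int q\<bar>
      \<le> 3200 / ((real_of_int q)\<^sup>2 * (ln (ln q))\<^sup>2)"
    by (simp add: mult.commute)
  moreover have "3 < nat q" "N \<le> nat q" using q_ge lz l by linarith+
  ultimately show thesis using p_nonneg q_ge z by (intro that[of "nat q" "nat p"]) auto
qed

text \<open>The condition \<open>q \<ge> 2\<close> excludes 0 and 1, where \<open>ln (ln q)\<close>
  would rest on the default value of \<open>ln\<close> at 0.\<close>

theorem theorem1:
  "\<not> badly_approximable thue_morse_constant \<and>
   (\<exists>c>0. infinite {(p :: nat, q :: nat). q \<ge> 2 \<and>
      \<bar>thue_morse_constant - real p / real q\<bar> \<le> c / ((real q)\<^sup>2 * (ln (ln (real q)))\<^sup>2)})"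
proof
  show "\<not> badly_approximable thue_morse_constant"
  proof
    assume "badly_approximable thue_morse_constant"
    then obtain c where c: "c > 0"
      "\<And>p q :: int. q \<ge> 1 \<Longrightarrow> c / (of_int q)\<^sup>2 < \<bar>thue_morse_constant - of_int p / of_int q\<bar>"
      unfolding badly_approximable_def by blast
    \<comment> \<open>Divergence of the squared iterated logarithm eventually beats any fixed
      \<open>c\<close>.\<close>
    have "filterlim (\<lambda>n::nat. (ln (ln (real n)))\<^sup>2) at_top sequentially"
      by (intro filterlim_pow_at_top filterlim_compose[OF ln_at_top] filterlim_real_sequentially) simp
    then have "eventually (\<lambda>n::nat. 3200 / c \<le> (ln (ln (real n)))\<^sup>2) sequentially"
      by (simp add: filterlim_at_top)
    then obtain N where N: "\<And>n. n \<ge> N \<Longrightarrow> 3200 / c \<le> (ln (ln (real n)))\<^sup>2"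
      unfolding eventually_sequentially by blast
    obtain p q :: nat where pq: "3 < q" "N \<le> q"
      "\<bar>thue_morse_constant - real p / real q\<bar> \<le> 3200 / ((real q)\<^sup>2 * (ln (ln (real q)))\<^sup>2)"
      by (rule thue_morse_good_approximation)
    have "c / (real q)\<^sup>2 < 3200 / ((real q)\<^sup>2 * (ln (ln (real q)))\<^sup>2)"
      using c(2)[of "int q" "int p"] pq by simp
    moreover have "0 < ln (ln (real q))" using pq by (intro ln_ln_pos) simp
    ultimately have "c * (ln (ln (real q)))\<^sup>2 < 3200"
      using pq by (simp add: field_simps)
    moreover have "3200 \<le> c * (ln (ln (real q)))\<^sup>2"
      using N[OF pq(2)] c(1) by (simp add: field_simps)
    ultimately show False by simp
  qed
next
  let ?S = "{(p :: nat, q :: nat). q \<ge> 2 \<and>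
      \<bar>thue_morse_constant - real p / real q\<bar> \<le> 3200 / ((real q)\<^sup>2 * (ln (ln (real q)))\<^sup>2)}"
  \<comment> \<open>Unbounded denominators already force infinitely many pairs.\<close>
  have "\<exists>q\<in>snd ` ?S. N < q" for N
  proof -
    obtain p q :: nat where "3 < q" "Suc N \<le> q"
      "\<bar>thue_morse_constant - real p / real q\<bar> \<le> 3200 / ((real q)\<^sup>2 * (ln (ln (real q)))\<^sup>2)"
      by (rule thue_morse_good_approximation)
    then show ?thesis by (intro bexI[of _ q] image_eqI[of _ _ "(p, q)"]) auto
  qed
  then have "infinite (snd ` ?S)"
    unfolding finite_nat_set_iff_bounded by (meson less_asym)
  then have "infinite ?S" by (rule contrapos_nn) (rule finite_imageI)
  then show "\<exists>c>0. infinite {(p :: nat, q :: nat). q \<ge> 2 \<and>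
      \<bar>thue_morse_constant - real p / real q\<bar> \<le> c / ((real q)\<^sup>2 * (ln (ln (real q)))\<^sup>2)}"
    by (intro exI[of _ 3200]) simp
qed

end
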